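(* The map from matroids to $\mathbb{Z}[t]$ assigning to each non-empty loopless matroid $\mathsf{M}$ its chain polynomial $f_{\Delta(\widehat{\mathcal{L}}(\mathsf{M}))}(t)$, and to each matroid that either has loops or is empty the zero polynomial, is a valuative invariant.
   Context: All matroids have finite ground sets contained in the positive integers; a matroid is non-empty if its ground set is. For a loopless matroid $\mathsf{M}$ on a non-empty set $E$, $\mathcal{L}(\mathsf{M})$ is its lattice of flats, $\widehat{\mathcal{L}}(\mathsf{M})=\mathcal{L}(\mathsf{M})\smallsetminus\{\varnothing,E\}$, and $\Delta(\widehat{\mathcal{L}}(\mathsf{M}))$ is the order complex of the poset $\widehat{\mathcal{L}}(\mathsf{M})$. For a simplicial complex $\Delta$ let $f_i=|\{F\in\Delta: |F|=i\}|$ for $i\ge0$ and let $d$ be the size of a largest face; the $f$-polynomial is $f_{\Delta}(t)=\sum_{i=0}^d f_i\,t^{d-i}$. Thus the $f_i$ count chains $\varnothing\subsetneq F_1\subsetneq\cdots\subsetneq F_i\subsetneq E$ of flats, and $f_{\Delta(\widehat{\mathcal{L}}(\mathsf{M}))}$ is called the chain polynomial of $\mathsf{M}$. The base polytope of a matroid $\mathsf{M}$ on $E$ with bases $\mathscr{B}$ is $\mathscr{P}(\mathsf{M})=\operatorname{conv}\{\sum_{i\in B}e_i : B\in\mathscr{B}\}\subseteq\mathbb{R}^E$, with indicator function $\mathbf{1}_{\mathscr{P}(\mathsf{M})}:\mathbb{R}^E\to\mathbb{Z}$. A map $f$ from matroids to an abelian group is a valuation if $\sum_{i}a_if(\mathsf{M}_i)=0$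 whenever $\mathsf{M}_1,\dots,\mathsf{M}_s$ are matroids on a common ground set and $a_i\in\mathbb{Z}$ satisfy $\sum_i a_i\mathbf{1}_{\mathscr{P}(\mathsf{M}_i)}=0$. (This is known to be equivalent to the inclusion–exclusion property under matroid subdivisions.) A valuative invariant is a valuation with $f(\mathsf{M})=f(\mathsf{N})$ whenever $\mathsf{M}\cong\mathsf{N}$. *)

theory Defs
  imports "HOL-Analysis.Analysis" "HOL-Analysis.Finite_Function_Topology"
     "HOL-Computational_Algebra.Polynomial"
begin

text \<open>A matroid is a pair of a ground set, which is a finite set of positive integers, and its
  set of bases.\<close>

typedef matroid =
  "{(E :: nat set, \<B> :: nat set set).
      finite E \<and> E \<subseteq> {1..} \<and> \<B> \<noteq> {} \<and> (\<forall>B\<in>\<B>. B \<subseteq> E) \<and>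
      (\<forall>B\<^sub>1\<in>\<B>. \<forall>B\<^sub>2\<in>\<B>. \<forall>x\<in>B\<^sub>1 - B\<^sub>2. \<exists>y\<in>B\<^sub>2 - B\<^sub>1. insert y (B\<^sub>1 - {x}) \<in> \<B>)}"
  by (rule exI[of _ "({}, {{}})"]) auto

definition ground :: "matroid \<Rightarrow> nat set" where
  "ground M = fst (Rep_matroid M)"

definition bases :: "matroid \<Rightarrow> nat set set" where
  "bases M = snd (Rep_matroid M)"

lemma finite_ground: "finite (ground M)"
  and ground_pos: "ground M \<subseteq> {1..}"
  and bases_nonempty: "bases M \<noteq> {}"
  and bases_subset_ground: "B \<in> bases M \<Longrightarrow> B \<subseteq> ground M"
  and basis_exchange: "\<lbrakk>B\<^sub>1 \<in> bases M; B\<^sub>2 \<in> bases M; x \<in> B\<^sub>1 - B\<^sub>2\<rbrakk>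
        \<Longrightarrow> \<exists>y\<in>B\<^sub>2 - B\<^sub>1. insert y (B\<^sub>1 - {x}) \<in> bases M"
  using Rep_matroid[of M] by (auto simp: ground_def bases_def split: prod.splits)

definition indep :: "matroid \<Rightarrow> nat set \<Rightarrow> bool" where
  "indep M I \<longleftrightarrow> (\<exists>B\<in>bases M. I \<subseteq> B)"

definition matroid_rank :: "matroid \<Rightarrow> nat set \<Rightarrow> nat" where
  "matroid_rank M X = Max {card I | I. I \<subseteq> X \<and> indep M I}"

definition loopless :: "matroid \<Rightarrow> bool" where
  "loopless M \<longleftrightarrow> (\<forall>x\<in>ground M. indep M {x})"

definition flats :: "matroid \<Rightarrow> nat set set" where
  "flats M = {F. F \<subseteq> ground M \<and>
     (\<forall>x\<in>ground M - F. matroid_rank M F < matroid_rank M (insert x F))}"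

definition proper_flats :: "matroid \<Rightarrow> nat set set" where
  "proper_flats M = flats M - {{}, ground M}"

definition matroid_iso :: "matroid \<Rightarrow> matroid \<Rightarrow> bool" where
  "matroid_iso M N \<longleftrightarrow>
     (\<exists>\<phi>. bij_betw \<phi> (ground M) (ground N) \<and> bases N = (\<lambda>B. \<phi> ` B) ` bases M)"

definition order_complex :: "'a set set \<Rightarrow> 'a set set set" where
  "order_complex P = {C. finite C \<and> subset.chain P C}"

definition f_number :: "'a set set \<Rightarrow> nat \<Rightarrow> nat" where
  "f_number \<Delta> i = card {F \<in> \<Delta>. card F = i}"

definition f_polynomial :: "'a set set \<Rightarrow> int poly" where
  "f_polynomial \<Delta> =
     (let d = Max (card ` \<Delta>) in \<Sum>i\<le>d. monom (int (f_number \<Delta> i)) (d - i))"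

definition chain_polynomial :: "matroid \<Rightarrow> int poly" where
  "chain_polynomial M = f_polynomial (order_complex (proper_flats M))"

text \<open>\<open>\<real>\<^sup>E\<close> is realised as the space of finitely supported functions on \<^typ>\<open>nat\<close> whose
  support lies in \<open>E\<close>.\<close>

definition coord_space :: "nat set \<Rightarrow> (nat \<Rightarrow>\<^sub>0 real) set" where
  "coord_space E = {x. Poly_Mapping.keys x \<subseteq> E}"

definition base_polytope :: "matroid \<Rightarrow> (nat \<Rightarrow>\<^sub>0 real) set" where
  "base_polytope M = convex hull ((\<lambda>B. \<Sum>i\<in>B. Poly_Mapping.single i 1) ` bases M)"

text \<open>The integer multiple \<open>k x\<close> in an abelian group; at most one of the two sums is non-empty.\<close>

definition int_scale :: "int \<Rightarrow> 'a::ab_group_add \<Rightarrow> 'a" where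
  "int_scale k x = (\<Sum>j<nat k. x) - (\<Sum>j<nat (- k). x)"

lemma int_scale_ring: "int_scale k (x :: 'a::ring_1) = of_int k * x"
  by (cases "k \<ge> 0") (auto simp: int_scale_def of_nat_nat)

definition valuation :: "(matroid \<Rightarrow> 'a::ab_group_add) \<Rightarrow> bool" where
  "valuation f \<longleftrightarrow>
     (\<forall>(E :: nat set) (s :: nat) (M :: nat \<Rightarrow> matroid) (a :: nat \<Rightarrow> int).
        (\<forall>i\<in>{1..s}. ground (M i) = E) \<longrightarrow>
        (\<forall>x\<in>coord_space E. (\<Sum>i=1..s. a i * indicator (base_polytope (M i)) x) = 0) \<longrightarrow>
        (\<Sum>i=1..s. int_scale (a i) (f (M i))) = 0)"

definition valuative_invariant :: "(matroid \<Rightarrow> 'a::ab_group_add) \<Rightarrow> bool" where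
  "valuative_invariant f \<longleftrightarrow>
     valuation f \<and> (\<forall>M N. matroid_iso M N \<longrightarrow> f M = f N)"

end

theory Submission
  imports Defs
begin

text \<open>A chain \<open>C\<close> of subsets of the ground set \<open>E\<close> consists of flats of a loopless matroid \<open>M\<close>
  precisely if the face of the base polytope maximising \<open>w(x) = \<Sum>F\<in>C. x(F)\<close> belongs to a
  loopless matroid. For small \<open>\<delta> > 0\<close> this can be read off from the maximum of \<open>w\<close> on
  \<open>P(M) \<inter> {x. \<forall>e\<in>E. x\<^sub>e \<ge> \<delta>}\<close>: it is an integer if the face matroid is loopless, and lies just
  below an integer (or the set is empty) otherwise. Therefore \<open>[M loopless, C \<subseteq> flats M]\<close> is a
  combination of terms \<open>[P(M) \<inter> L \<noteq> {}]\<close> with \<open>L\<close> closed and convex. Each such term is valuative,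
  because a relation \<open>\<Sum>a\<^sub>i 1\<^bsub>K\<^sub>i\<^esub> = 0\<close> between compact convex sets implies
  \<open>\<Sum>a\<^sub>i [K\<^sub>i \<noteq> {}] = 0\<close>, by induction on the number of coordinates; in dimension one, the number
  of points of an interval that stop belonging to it after an infinitesimal move to the right is one.
  As all maximal chains of proper flats have size \<open>rank - 1\<close>, and base polytopes of
  different ranks lie in disjoint hyperplanes, summing over all chains gives the result.\<close>

section \<open>Relations between indicator functions of compact convex sets\<close>

text \<open>Points left of \<open>J\<close> stay outside under a small move to the right, points of
  \<open>J\<close> before its right end stay inside, and only the right end drops out. This
  expresses non-emptiness of \<open>J\<close> through membership alone.\<close>

lemma interval_right_end:
  fixes J :: "real set"
  assumes "compact J" "convex J"
  shows "\<forall>\<^sub>F \<epsilon> in at_right 0. (of_bool (y \<in> J) - of_bool (y + \<epsilon> \<in> J) :: int)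
    = of_bool (J \<noteq> {} \<and> y = Sup J)"
proof (cases "J = {}")
  case False
  obtain l u where J: "J = {l..u}"
    using assms connected_compact_interval_1 convex_connected by metis
  with False have "l \<le> u" by simp
  have pos: "\<forall>\<^sub>F \<epsilon> in at_right 0. \<epsilon> < d" if "d > 0" for d :: real
    using eventually_at_right_less that by (auto simp: eventually_at_right_field)
  \<comment> \<open>The step has to stay below the distance to an end point only if that end point
    lies to the right of \<open>y\<close>.\<close>
  have "\<forall>\<^sub>F \<epsilon> in at_right 0. y < u \<longrightarrow> \<epsilon> < u - y" "\<forall>\<^sub>F \<epsilon> in at_right 0. y < l \<longrightarrow> \<epsilon> < l - y"
    using pos[of "u - y"] pos[of "l - y"] by (cases "y < u"; cases "y < l"; auto)+
  moreover have "\<forall>\<^sub>F \<epsilon> in at_right 0. \<epsilon> > (0::real)"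
    by (simp add: eventually_at_right_less)
  ultimately show ?thesis
  proof eventually_elim
    case (elim \<epsilon>)
    have "Sup J = u" using \<open>l \<le> u\<close> by (simp add: J)
    have "(y \<in> J \<longleftrightarrow> y + \<epsilon> \<in> J \<or> y = u) \<and> (y = u \<longrightarrow> y + \<epsilon> \<notin> J)"
      using elim \<open>l \<le> u\<close> unfolding J atLeastAtMost_iff by linarith
    then show ?case using False \<open>Sup J = u\<close> by (cases "y = u") simp_all
  qed
qed simp

text \<open>Each non-empty interval has exactly one right end, so its non-emptiness is a sum of
  membership differences over finitely many \<open>y\<close>. One step size serves all the finitely
  many pairs at once.\<close>

lemma sum_nonempty_intervals_eq_0:
  fixes J :: "'i \<Rightarrow> real set" and a :: "'i \<Rightarrow> int"
  assumes "finite I" and J: "\<And>i. i \<in> I \<Longrightarrow> compact (J i)" "\<And>i. i \<in> I \<Longrightarrow> convex (J i)"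
    and zero: "\<And>y. (\<Sum>i\<in>I. a i * of_bool (y \<in> J i)) = 0"
  shows "(\<Sum>i\<in>I. a i * of_bool (J i \<noteq> {})) = 0"
proof -
  \<comment> \<open>For an empty \<open>J i\<close> the value \<open>Sup (J i)\<close> is
    meaningless; the test \<open>J i \<noteq> {}\<close> below makes its contribution zero.\<close>
  define T where "T = (\<lambda>i. Sup (J i)) ` I"
  have "finite T" using \<open>finite I\<close> by (simp add: T_def)
  have "\<forall>\<^sub>F \<epsilon> in at_right 0. \<forall>i\<in>I. \<forall>y\<in>T.
      (of_bool (y \<in> J i) - of_bool (y + \<epsilon> \<in> J i) :: int) = of_bool (J i \<noteq> {} \<and> y = Sup (J i))"
    using \<open>finite I\<close> \<open>finite T\<close> J interval_right_end by (intro eventually_ball_finite ballI) auto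
  then obtain \<epsilon> where "\<forall>i\<in>I. \<forall>y\<in>T.
      (of_bool (y \<in> J i) - of_bool (y + \<epsilon> \<in> J i) :: int) = of_bool (J i \<noteq> {} \<and> y = Sup (J i))"
    using eventually_happens'[OF trivial_limit_at_right_real] by force
  then have \<epsilon>: "\<And>i y. i \<in> I \<Longrightarrow> y \<in> T \<Longrightarrow>
      (of_bool (y \<in> J i) - of_bool (y + \<epsilon> \<in> J i) :: int) = of_bool (J i \<noteq> {} \<and> y = Sup (J i))"
    by blast
  have "(\<Sum>y\<in>T. of_bool (J i \<noteq> {} \<and> y = Sup (J i))) = (of_bool (J i \<noteq> {}) :: int)" if "i \<in> I" for i
  proof -
    have "Sup (J i) \<in> T" using that by (simp add: T_def)
    then show ?thesis using \<open>finite T\<close> by (cases "J i = {}") (simp_all add: of_bool_def)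
  qed
  then have "(\<Sum>i\<in>I. a i * of_bool (J i \<noteq> {}))
      = (\<Sum>i\<in>I. a i * (\<Sum>y\<in>T. of_bool (J i \<noteq> {} \<and> y = Sup (J i))))"
    by (intro sum.cong) simp_all
  also have "\<dots> = (\<Sum>i\<in>I. a i * (\<Sum>y\<in>T. of_bool (y \<in> J i) - of_bool (y + \<epsilon> \<in> J i)))"
    by (intro sum.cong refl arg_cong2[where f = "(*)"]) (simp add: \<epsilon>)
  \<comment> \<open>After the exchange of sums both inner sums are instances of \<open>zero\<close>,
    at \<open>y\<close> and at \<open>y + \<epsilon>\<close>.\<close>
  also have "\<dots> = (\<Sum>y\<in>T. (\<Sum>i\<in>I. a i * of_bool (y \<in> J i)) - (\<Sum>i\<in>I. a i * of_bool (y + \<epsilon> \<in> J i)))"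
    unfolding sum_distrib_left by (subst sum.swap) (simp add: right_diff_distrib sum_subtractf)
  finally show ?thesis by (simp add: zero)
qed

text \<open>The hypothesis concerns the common fibres of the functionals in \<open>K\<close>. Each
  induction step removes one functional by the interval case; with none left, the fibre condition
  only says that \<open>S i\<close> is non-empty.\<close>

lemma sum_nonempty_convex_eq_0:
  fixes S :: "'i \<Rightarrow> 'v::real_normed_vector set" and \<phi> :: "'k \<Rightarrow> 'v \<Rightarrow> real" and a :: "'i \<Rightarrow> int"
  assumes "finite I" "finite K" and lin: "\<And>k. bounded_linear (\<phi> k)"
    and S: "\<And>i. i \<in> I \<Longrightarrow> compact (S i)" "\<And>i. i \<in> I \<Longrightarrow> convex (S i)"
    and zero: "\<And>y. (\<Sum>i\<in>I. a i * of_bool (\<exists>x\<in>S i. \<forall>k\<in>K. \<phi> k x = y k)) = 0"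
  shows "(\<Sum>i\<in>I. a i * of_bool (S i \<noteq> {})) = 0"
  using \<open>finite K\<close> zero
proof (induction K)
  case empty
  from empty[of undefined] show ?case by (simp add: ex_in_conv)
next
  case (insert k K)
  show ?case
  proof (rule insert.IH)
    fix y
    \<comment> \<open>With the values on \<open>K\<close> fixed, the image of a slice under
      \<open>\<phi> k\<close> is a compact interval, and it contains \<open>c\<close> iff the fibre
      over \<open>y(k := c)\<close> meets \<open>S i\<close>.\<close>
    define slice where "slice i = S i \<inter> (\<Inter>j\<in>K. {x. \<phi> j x = y j})" for i
    have "closed {x. \<phi> j x = c}" "convex {x. \<phi> j x = c}" for j c
    proof -
      interpret bounded_linear "\<phi> j" by (rule lin)
      show "closed {x. \<phi> j x = c}"
        by (intro closed_Collect_eq continuous_intros linear_continuous_on lin)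
      show "convex {x. \<phi> j x = c}"
        by (rule convexI) (simp add: add scaleR distrib_right[symmetric])
    qed
    then have slice: "compact (slice i)" "convex (slice i)" if "i \<in> I" for i
      using S[OF that] unfolding slice_def
      by (auto intro!: compact_Int_closed closed_INT convex_Int convex_INT)
    have "(\<Sum>i\<in>I. a i * of_bool (\<phi> k ` slice i \<noteq> {})) = 0"
    proof (rule sum_nonempty_intervals_eq_0[OF \<open>finite I\<close>])
      fix i assume "i \<in> I"
      then show "compact (\<phi> k ` slice i)" "convex (\<phi> k ` slice i)"
        using compact_continuous_image[OF linear_continuous_on[OF lin]] slice
          convex_linear_image[OF bounded_linear.linear[OF lin]] by blast+
    next
      fix c
      have "c \<in> \<phi> k ` slice i \<longleftrightarrow> (\<exists>x\<in>S i. \<forall>j\<in>insert k K. \<phi> j x = (y(k := c)) j)" for i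
        using insert.hyps by (auto simp: slice_def image_iff Bex_def)
      then show "(\<Sum>i\<in>I. a i * of_bool (c \<in> \<phi> k ` slice i)) = 0"
        using insert.prems[of "y(k := c)"] by simp
    qed
    moreover have "\<phi> k ` slice i \<noteq> {} \<longleftrightarrow> (\<exists>x\<in>S i. \<forall>j\<in>K. \<phi> j x = y j)" for i
      by (auto simp: slice_def)
    ultimately show "(\<Sum>i\<in>I. a i * of_bool (\<exists>x\<in>S i. \<forall>j\<in>K. \<phi> j x = y j)) = 0"
      by simp
  qed
qed

text \<open>The norm is the sum of the absolute values of the coordinates, hence bounds each of
  them.\<close>

lemma bounded_linear_lookup: "bounded_linear (\<lambda>x :: 'a \<Rightarrow>\<^sub>0 real. Poly_Mapping.lookup x e)"
proof (rule bounded_linear_intro)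
  fix x y :: "'a \<Rightarrow>\<^sub>0 real" and r :: real
  show "Poly_Mapping.lookup (x + y) e = Poly_Mapping.lookup x e + Poly_Mapping.lookup y e"
    by (simp add: lookup_add)
  show "Poly_Mapping.lookup (r *\<^sub>R x) e = r *\<^sub>R Poly_Mapping.lookup x e"
    by (simp add: scaleR_poly_mapping_def)
  show "norm (Poly_Mapping.lookup x e) \<le> norm x * 1"
    by (cases "e \<in> Poly_Mapping.keys x")
      (auto simp: norm_poly_mapping_def dist_poly_mapping_def in_keys_iff sum_nonneg intro!: member_le_sum)
qed

section \<open>Bases, rank and initial matroids\<close>

lemma finite_basis: "B \<in> bases M \<Longrightarrow> finite B"
  using bases_subset_ground finite_ground finite_subset by blast

lemma finite_bases: "finite (bases M)"
  by (rule finite_subset[of _ "Pow (ground M)"]) (use bases_subset_ground finite_ground in auto)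

lemma indep_subset_ground: "indep M I \<Longrightarrow> I \<subseteq> ground M"
  using bases_subset_ground by (auto simp: indep_def)

lemma finite_indep: "indep M I \<Longrightarrow> finite I"
  using indep_subset_ground finite_ground finite_subset by blast

lemma indep_subset: "indep M J \<Longrightarrow> I \<subseteq> J \<Longrightarrow> indep M I"
  by (auto simp: indep_def)

lemma indep_empty: "indep M {}"
  using bases_nonempty by (auto simp: indep_def)

text \<open>Elements of \<open>B\<close> outside \<open>I\<close> and \<open>B'\<close> are
  exchanged one by one for elements of \<open>B'\<close>; \<open>I\<close> is never touched.\<close>

lemma basis_extension:
  assumes "B \<in> bases M" "B' \<in> bases M" "I \<subseteq> B"
  shows "\<exists>B\<^sub>1\<in>bases M. I \<subseteq> B\<^sub>1 \<and> B\<^sub>1 \<subseteq> I \<union> B'"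
  using assms
proof (induction "card (B - I - B')" arbitrary: B rule: less_induct)
  case less
  show ?case
  proof (cases "B \<subseteq> I \<union> B'")
    case False
    then obtain z where z: "z \<in> B - B'" "z \<notin> I" by auto
    then obtain y where y: "y \<in> B' - B" "insert y (B - {z}) \<in> bases M"
      using basis_exchange less.prems by blast
    have "insert y (B - {z}) - I - B' \<subset> B - I - B'" using less.prems z y(1) by auto
    then have "card (insert y (B - {z}) - I - B') < card (B - I - B')"
      using finite_basis[OF less.prems(1)] by (intro psubset_card_mono) auto
    moreover have "I \<subseteq> insert y (B - {z})" using z less.prems(3) by auto
    ultimately show ?thesis using less.hyps y(2) less.prems(2) by metis
  qed (use less.prems in blast)
qed

text \<open>Exchanges towards \<open>B'\<close> preserve the size of \<open>B\<close> and shrink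
  \<open>B - B'\<close> until \<open>B\<close> is contained in \<open>B'\<close>.\<close>

lemma card_basis_le:
  assumes "B \<in> bases M" "B' \<in> bases M"
  shows "card B \<le> card B'"
  using assms(1)
proof (induction "card (B - B')" arbitrary: B rule: less_induct)
  case less
  show ?case
  proof (cases "B \<subseteq> B'")
    case True
    then show ?thesis using card_mono finite_basis[OF assms(2)] by blast
  next
    case False
    then obtain z where z: "z \<in> B - B'" by auto
    then obtain y where y: "y \<in> B' - B" "insert y (B - {z}) \<in> bases M"
      using basis_exchange less.prems assms(2) by blast
    have "insert y (B - {z}) - B' \<subset> B - B'" using z y(1) by auto
    then have "card (insert y (B - {z}) - B') < card (B - B')"
      using finite_basis[OF less.prems] by (intro psubset_card_mono) auto
    moreover have "card (insert y (B - {z})) = card B"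
      using card_Suc_Diff1[OF finite_basis[OF less.prems], of z] finite_basis[OF less.prems] y(1) z
      by (metis DiffE card_insert_disjoint finite_Diff)
    ultimately show ?thesis using less.hyps y(2) by metis
  qed
qed

lemma card_basis_eq: "B \<in> bases M \<Longrightarrow> B' \<in> bases M \<Longrightarrow> card B = card B'"
  by (simp add: card_basis_le le_antisym)

text \<open>If no element of \<open>J\<close> could be added, a basis that completes
  \<open>I\<close> by elements of a basis \<open>B'\<close> above \<open>J\<close> would use only
  elements of \<open>B' - J\<close>. Bases being equally large, \<open>J\<close> could then not
  exceed \<open>I\<close> in size.\<close>

lemma indep_augment:
  assumes "indep M I" "indep M J" "card I < card J"
  shows "\<exists>x\<in>J - I. indep M (insert x I)"
proof (rule ccontr)
  assume contra: "\<not> ?thesis"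
  obtain B B' where B: "B \<in> bases M" "I \<subseteq> B" and B': "B' \<in> bases M" "J \<subseteq> B'"
    using assms by (auto simp: indep_def)
  obtain B\<^sub>1 where B\<^sub>1: "B\<^sub>1 \<in> bases M" "I \<subseteq> B\<^sub>1" "B\<^sub>1 \<subseteq> I \<union> B'"
    using basis_extension[OF B(1) B'(1) B(2)] by blast
  have "B\<^sub>1 - I \<subseteq> B' - J"
    using contra B\<^sub>1 by (auto simp: indep_def)
  then have "card (B\<^sub>1 - I) \<le> card (B' - J)"
    using finite_basis B' by (intro card_mono) auto
  moreover have "card (B\<^sub>1 - I) = card B\<^sub>1 - card I" "card (B' - J) = card B' - card J"
    using assms B\<^sub>1 B' finite_indep by (auto intro: card_Diff_subset)
  moreover have "card B\<^sub>1 = card B'" "card J \<le> card B'"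
    using B\<^sub>1 B' finite_basis by (auto intro: card_basis_eq card_mono)
  ultimately show False using assms(3) by linarith
qed

text \<open>Completing \<open>insert x I\<close> inside \<open>insert x B\<close> gives a basis of
  the size of \<open>B\<close>, so exactly one element is left out, and it does not lie in
  \<open>insert x I\<close>.\<close>

lemma basis_swap:
  assumes B: "B \<in> bases M" and "I \<subseteq> B" "indep M (insert x I)" "x \<notin> B"
  shows "\<exists>y\<in>B - I. insert x (B - {y}) \<in> bases M"
proof -
  obtain B' where B': "B' \<in> bases M" "insert x I \<subseteq> B'"
    using assms by (auto simp: indep_def)
  obtain B\<^sub>1 where B\<^sub>1: "B\<^sub>1 \<in> bases M" "insert x I \<subseteq> B\<^sub>1" "B\<^sub>1 \<subseteq> insert x I \<union> B"
    using basis_extension[OF B'(1) B B'(2)] by blast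
  have "B\<^sub>1 \<subseteq> insert x B" using B\<^sub>1(3) \<open>I \<subseteq> B\<close> by auto
  then have "card (insert x B - B\<^sub>1) = 1"
    using card_basis_eq[OF B B\<^sub>1(1)] finite_basis[OF B] finite_basis[OF B\<^sub>1(1)] \<open>x \<notin> B\<close>
    by (simp add: card_Diff_subset)
  then obtain y where y: "insert x B - B\<^sub>1 = {y}" using card_1_singletonE by blast
  then have "y \<in> B - I" "B\<^sub>1 = insert x (B - {y})"
    using \<open>B\<^sub>1 \<subseteq> insert x B\<close> B\<^sub>1(2) by auto
  then show ?thesis using B\<^sub>1(1) by blast
qed

section \<open>The rank function\<close>

lemma finite_indep_cards: "finite {card I | I. I \<subseteq> X \<and> indep M I}"
  by (rule finite_subset[of _ "card ` Pow (ground M)"])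
    (use finite_ground indep_subset_ground in auto)

lemma card_le_rank: "I \<subseteq> X \<Longrightarrow> indep M I \<Longrightarrow> card I \<le> matroid_rank M X"
  unfolding matroid_rank_def by (rule Max_ge[OF finite_indep_cards]) auto

lemma rank_attained: "\<exists>I\<subseteq>X. indep M I \<and> card I = matroid_rank M X"
proof -
  have "matroid_rank M X \<in> {card I | I. I \<subseteq> X \<and> indep M I}"
    unfolding matroid_rank_def
    by (rule Max_in[OF finite_indep_cards]) (use indep_empty in auto)
  then obtain I where "matroid_rank M X = card I" "I \<subseteq> X" "indep M I" by blast
  then show ?thesis by metis
qed

lemma rank_mono: "X \<subseteq> Y \<Longrightarrow> matroid_rank M X \<le> matroid_rank M Y"
  by (metis card_le_rank dual_order.trans rank_attained)

lemma rank_ground: "B \<in> bases M \<Longrightarrow> matroid_rank M (ground M) = card B"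
proof (rule antisym)
  assume B: "B \<in> bases M"
  show "card B \<le> matroid_rank M (ground M)"
    using B bases_subset_ground by (intro card_le_rank) (auto simp: indep_def)
  obtain I B' where "card I = matroid_rank M (ground M)" "I \<subseteq> B'" "B' \<in> bases M"
    using rank_attained by (metis indep_def)
  then show "matroid_rank M (ground M) \<le> card B"
    using card_basis_eq[OF B] finite_basis by (metis card_mono)
qed

lemma rank_insert_le: "matroid_rank M (insert x X) \<le> Suc (matroid_rank M X)"
proof -
  obtain I where I: "I \<subseteq> insert x X" "indep M I" "card I = matroid_rank M (insert x X)"
    using rank_attained by blast
  have "card (I - {x}) \<le> matroid_rank M X"
    using I by (intro card_le_rank) (auto intro: indep_subset)
  moreover have "card I \<le> Suc (card (I - {x}))"
    using finite_indep[OF I(2)] by (cases "x \<in> I") simp_all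
  ultimately show ?thesis using I(3) by linarith
qed

lemma rank_flat_less:
  assumes "F \<in> flats M" "G \<subseteq> ground M" "F \<subset> G"
  shows "matroid_rank M F < matroid_rank M G"
proof -
  obtain x where "x \<in> G" "x \<notin> F" using assms(3) by blast
  then have "matroid_rank M F < matroid_rank M (insert x F)" "insert x F \<subseteq> G"
    using assms by (auto simp: flats_def)
  then show ?thesis by (meson rank_mono less_le_trans)
qed

text \<open>The bases maximising \<open>weight C\<close> are those of the initial matroid of \<open>M\<close> for the weight
  \<open>\<Sum>F\<in>C. 1\<^bsub>F\<^esub>\<close>, that is, the vertices of the face of the base polytope on which this
  functional is maximal.\<close>

definition weight :: "nat set set \<Rightarrow> nat set \<Rightarrow> nat" where
  "weight C B = (\<Sum>F\<in>C. card (B \<inter> F))"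

definition max_bases :: "matroid \<Rightarrow> nat set set \<Rightarrow> nat set set" where
  "max_bases M C = {B \<in> bases M. \<forall>B'\<in>bases M. weight C B' \<le> weight C B}"

definition loopless_initial :: "matroid \<Rightarrow> nat set set \<Rightarrow> bool" where
  "loopless_initial M C \<longleftrightarrow> (\<forall>e\<in>ground M. \<exists>B\<in>max_bases M C. e \<in> B)"

lemma max_bases_nonempty: "max_bases M C \<noteq> {}"
proof -
  have "Max (weight C ` bases M) \<in> weight C ` bases M"
    using finite_bases bases_nonempty by (intro Max_in) auto
  then obtain B where "B \<in> bases M" "weight C B = Max (weight C ` bases M)" by auto
  then have "B \<in> max_bases M C" by (auto simp: max_bases_def finite_bases)
  then show ?thesis by blast
qed

text \<open>The exchange loses an element of \<open>F\<close> only if \<open>y\<close> lies in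
  \<open>F\<close>, and then \<open>x\<close> replaces it.\<close>

lemma card_swap_Int_ge:
  assumes "finite B" "x \<notin> B" "y \<in> F \<Longrightarrow> x \<in> F"
  shows "card (B \<inter> F) \<le> card (insert x (B - {y}) \<inter> F)"
proof (cases "y \<in> B \<inter> F")
  case True
  then have "insert x (B - {y}) \<inter> F = insert x (B \<inter> F - {y})" using assms by auto
  then show ?thesis using True assms by simp
next
  case False
  then show ?thesis using assms by (intro card_mono) auto
qed

text \<open>If \<open>|B \<inter> F|\<close> were too small, exchanging an element outside \<open>F\<close> for one inside would
  increase the weight, because the members of \<open>C\<close> are nested.\<close>

lemma card_max_basis_Int:
  assumes "finite C" and chain: "subset.chain \<A> C" and B: "B \<in> max_bases M C" and F: "F \<in> C"
  shows "card (B \<inter> F) = matroid_rank M F"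
proof (rule antisym)
  have bas: "B \<in> bases M" using B by (simp add: max_bases_def)
  have "indep M (B \<inter> F)" using bas by (auto simp: indep_def)
  then show "card (B \<inter> F) \<le> matroid_rank M F" by (intro card_le_rank) auto
  show "matroid_rank M F \<le> card (B \<inter> F)"
  proof (rule ccontr)
    assume less: "\<not> ?thesis"
    obtain I where I: "I \<subseteq> F" "indep M I" "card I = matroid_rank M F"
      using rank_attained by blast
    then obtain x where x: "x \<in> I - B \<inter> F" "indep M (insert x (B \<inter> F))"
      using less indep_augment[OF \<open>indep M (B \<inter> F)\<close> I(2)] by auto
    then have xF: "x \<in> F" "x \<notin> B" using I by auto
    then obtain y where y: "y \<in> B - F" "insert x (B - {y}) \<in> bases M"
      using basis_swap[OF bas _ x(2)] by auto
    have "weight C B < weight C (insert x (B - {y}))"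
      unfolding weight_def
    proof (rule sum_strict_mono_ex1[OF \<open>finite C\<close>])
      show "\<forall>G\<in>C. card (B \<inter> G) \<le> card (insert x (B - {y}) \<inter> G)"
      proof
        fix G assume "G \<in> C"
        \<comment> \<open>If \<open>G\<close> is inside \<open>F\<close>, then \<open>y\<close> is
          not in \<open>G\<close>; if \<open>G\<close> contains \<open>F\<close>, then
          \<open>x\<close> is in \<open>G\<close>. In both cases the exchange loses nothing on
          \<open>G\<close>.\<close>
        then have "G \<subseteq> F \<or> F \<subseteq> G"
          using chain F by (auto simp: subset.chain_def)
        then show "card (B \<inter> G) \<le> card (insert x (B - {y}) \<inter> G)"
          using xF y finite_basis[OF bas] by (intro card_swap_Int_ge) auto
      qed
      have "insert x (B - {y}) \<inter> F = insert x (B \<inter> F)" using xF y by auto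
      then have "card (B \<inter> F) < card (insert x (B - {y}) \<inter> F)"
        using finite_basis[OF bas] xF by simp
      then show "\<exists>G\<in>C. card (B \<inter> G) < card (insert x (B - {y}) \<inter> G)" using F by blast
    qed
    moreover have "weight C (insert x (B - {y})) \<le> weight C B"
      using B y(2) unfolding max_bases_def by blast
    ultimately show False by simp
  qed
qed

text \<open>A maximal basis through \<open>e\<close> meets each \<open>F\<close> in \<open>C\<close>
  in a maximal independent subset of \<open>F\<close>, so a point \<open>e\<close> outside
  \<open>F\<close> raises the rank. Conversely, for flats any \<open>e\<close> can be exchanged into
  a maximal basis without loss of weight.\<close>

lemma loopless_initial_iff:
  assumes "finite C" and chain: "subset.chain (Pow (ground M)) C"
  shows "loopless_initial M C \<longleftrightarrow> loopless M \<and> C \<subseteq> flats M"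
proof (intro iffI conjI subsetI)
  assume ini: "loopless_initial M C"
  then show "loopless M"
    by (auto simp: loopless_def loopless_initial_def indep_def max_bases_def)
  fix F assume "F \<in> C"
  show "F \<in> flats M"
    unfolding flats_def
  proof (intro CollectI conjI ballI)
    show "F \<subseteq> ground M" using chain \<open>F \<in> C\<close> by (auto simp: subset.chain_def)
    fix e assume e: "e \<in> ground M - F"
    then obtain B where B: "B \<in> max_bases M C" "e \<in> B"
      using ini by (auto simp: loopless_initial_def)
    then have "B \<in> bases M" by (simp add: max_bases_def)
    have "matroid_rank M F < card (insert e (B \<inter> F))"
      using card_max_basis_Int[OF assms B(1) \<open>F \<in> C\<close>] e finite_basis[OF \<open>B \<in> bases M\<close>] by simp
    also have "\<dots> \<le> matroid_rank M (insert e F)"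
      using B \<open>B \<in> bases M\<close> by (intro card_le_rank) (auto simp: indep_def)
    finally show "matroid_rank M F < matroid_rank M (insert e F)" .
  qed
next
  assume flats: "loopless M \<and> C \<subseteq> flats M"
  show "loopless_initial M C"
    unfolding loopless_initial_def
  proof
    fix e assume e: "e \<in> ground M"
    obtain B where B: "B \<in> max_bases M C" using max_bases_nonempty by blast
    then have bas: "B \<in> bases M" by (simp add: max_bases_def)
    show "\<exists>B\<in>max_bases M C. e \<in> B"
    proof (cases "e \<in> B")
      case False
      \<comment> \<open>\<open>G\<close> is the largest member of \<open>C\<close> avoiding
        \<open>e\<close>, or empty if there is none; in the latter case looplessness gives
        independence.\<close>
      define G where "G = \<Union>{F \<in> C. e \<notin> F}"
      have "indep M (insert e (B \<inter> G))"
      proof (cases "{F \<in> C. e \<notin> F} = {}")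
        case True
        then have "G = {}" unfolding G_def by auto
        then show ?thesis using flats e by (simp add: loopless_def)
      next
        case False
        have "G \<in> {F \<in> C. e \<notin> F}"
          unfolding G_def
          by (rule Union_in_chain) (use assms False in \<open>auto simp: subset.chain_def\<close>)
        then have G: "G \<in> C" "e \<notin> G" by auto
        have rk: "card (B \<inter> G) = matroid_rank M G" by (rule card_max_basis_Int[OF assms B G(1)])
        also have "\<dots> < matroid_rank M (insert e G)"
          using flats G e by (auto simp: flats_def)
        finally obtain J where J: "J \<subseteq> insert e G" "indep M J" "card (B \<inter> G) < card J"
          using rank_attained by metis
        moreover have "indep M (B \<inter> G)" using bas by (auto simp: indep_def)
        ultimately obtain x where x: "x \<in> J - B \<inter> G" "indep M (insert x (B \<inter> G))"
          using indep_augment by blast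
        \<comment> \<open>Any other \<open>x\<close> would give an independent subset of
          \<open>G\<close> larger than its rank.\<close>
        have "x = e"
        proof (rule ccontr)
          assume "x \<noteq> e"
          then have "insert x (B \<inter> G) \<subseteq> G" using x J by auto
          then have "card (insert x (B \<inter> G)) \<le> card (B \<inter> G)"
            using x(2) rk card_le_rank by metis
          then show False using x finite_basis[OF bas] by auto
        qed
        then show ?thesis using x(2) by simp
      qed
      then obtain y where y: "y \<in> B - G" "insert e (B - {y}) \<in> bases M"
        using basis_swap[OF bas _ _ False] by blast
      \<comment> \<open>Since \<open>y\<close> is outside \<open>G\<close>, every member of
        \<open>C\<close> containing \<open>y\<close> also contains \<open>e\<close>.\<close>
      have "weight C B \<le> weight C (insert e (B - {y}))"
        unfolding weight_def
        by (rule sum_mono, rule card_swap_Int_ge)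
          (use y False finite_basis[OF bas] in \<open>auto simp: G_def\<close>)
      then have "insert e (B - {y}) \<in> max_bases M C"
        using B y(2) by (force simp: max_bases_def)
      then show ?thesis by blast
    qed (use B in blast)
  qed
qed

section \<open>Detecting loopless initial matroids on the base polytope\<close>

definition basis_vector :: "nat set \<Rightarrow> (nat \<Rightarrow>\<^sub>0 real)" where
  "basis_vector B = (\<Sum>i\<in>B. Poly_Mapping.single i 1)"

definition weight_functional :: "nat set set \<Rightarrow> (nat \<Rightarrow>\<^sub>0 real) \<Rightarrow> real" where
  "weight_functional C x = (\<Sum>F\<in>C. \<Sum>e\<in>F. Poly_Mapping.lookup x e)"

lemma base_polytope_eq: "base_polytope M = convex hull (basis_vector ` bases M)"
  by (simp add: base_polytope_def basis_vector_def image_def)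

lemma lookup_basis_vector:
  "finite B \<Longrightarrow> Poly_Mapping.lookup (basis_vector B) e = of_bool (e \<in> B)"
  by (simp add: basis_vector_def lookup_sum lookup_single when_def of_bool_def)

lemma bounded_linear_weight_functional: "bounded_linear (weight_functional C)"
  unfolding weight_functional_def by (intro bounded_linear_sum bounded_linear_lookup)

lemma weight_functional_basis_vector:
  assumes "finite B" "\<And>F. F \<in> C \<Longrightarrow> finite F"
  shows "weight_functional C (basis_vector B) = weight C B"
proof -
  have "(\<Sum>e\<in>F. of_bool (e \<in> B)) = real (card (B \<inter> F))" if "F \<in> C" for F
    using assms that by (simp add: Int_def conj_commute)
  then show ?thesis
    using assms by (simp add: weight_functional_def weight_def lookup_basis_vector)
qed

lemma linear_le_on_base_polytope:
  assumes h: "linear h" and le: "\<And>B. B \<in> bases M \<Longrightarrow> h (basis_vector B) \<le> (m::real)"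
    and x: "x \<in> base_polytope M"
  shows "h x \<le> m"
proof -
  have "convex {x. h x \<le> m}"
    using convex_linear_vimage[OF h convex_real_interval(2)[of m]]
    by (simp add: vimage_def)
  then have "base_polytope M \<subseteq> {x. h x \<le> m}"
    unfolding base_polytope_eq by (intro hull_minimal) (use le in auto)
  then show ?thesis using x by blast
qed

lemma base_polytope_linear_eq:
  assumes h: "linear h" and eq: "\<And>B. B \<in> bases M \<Longrightarrow> h (basis_vector B) = (m::real)"
    and x: "x \<in> base_polytope M"
  shows "h x = m"
proof (rule antisym)
  show "h x \<le> m" using linear_le_on_base_polytope[OF h _ x] eq by simp
  have "linear (\<lambda>x. - h x)" using h by (rule linear_compose_neg)
  then have "- h x \<le> - m" using linear_le_on_base_polytope[of "\<lambda>x. - h x" M "- m" x] eq x by simp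
  then show "m \<le> h x" by simp
qed

lemma linear_lookup: "linear (\<lambda>x :: 'a \<Rightarrow>\<^sub>0 real. Poly_Mapping.lookup x e)"
  by (rule bounded_linear.linear[OF bounded_linear_lookup])

lemma lookup_base_polytope_eq_0:
  assumes "x \<in> base_polytope M" "\<And>B. B \<in> bases M \<Longrightarrow> e \<notin> B"
  shows "Poly_Mapping.lookup x e = 0"
  by (rule base_polytope_linear_eq[OF linear_lookup _ assms(1)])
    (simp add: lookup_basis_vector finite_basis assms(2))

lemma base_polytope_subset_coord_space: "base_polytope M \<subseteq> coord_space (ground M)"
proof
  fix x assume x: "x \<in> base_polytope M"
  have "Poly_Mapping.lookup x e = 0" if "e \<notin> ground M" for e
    using lookup_base_polytope_eq_0[OF x] bases_subset_ground that by blast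
  then show "x \<in> coord_space (ground M)" by (auto simp: coord_space_def in_keys_iff)
qed

text \<open>This puts base polytopes of different ranks into disjoint hyperplanes, which later
  allows a relation to be split by rank.\<close>

lemma sum_lookup_base_polytope:
  assumes "x \<in> base_polytope M"
  shows "(\<Sum>e\<in>ground M. Poly_Mapping.lookup x e) = matroid_rank M (ground M)"
proof (rule base_polytope_linear_eq[OF _ _ assms])
  show "linear (\<lambda>x. \<Sum>e\<in>ground M. Poly_Mapping.lookup x e :: real)"
    by (intro linear_compose_sum ballI linear_lookup)
  fix B assume B: "B \<in> bases M"
  then have "ground M \<inter> B = B" using bases_subset_ground by blast
  then show "(\<Sum>e\<in>ground M. Poly_Mapping.lookup (basis_vector B) e) = matroid_rank M (ground M)"
    using B finite_ground finite_basis[OF B] by (simp add: lookup_basis_vector rank_ground Int_def)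
qed

text \<open>The coordinates indexed by \<open>E\<close> are taken as functionals. They determine a
  point supported in \<open>E\<close>, so every fibre is at most one point and the hypothesis on
  fibres follows from \<open>zero\<close>.\<close>

lemma sum_meets_base_polytope_eq_0:
  assumes "finite I" and ground: "\<And>i. i \<in> I \<Longrightarrow> ground (M i) = E"
    and zero: "\<And>x. x \<in> coord_space E \<Longrightarrow> (\<Sum>i\<in>I. a i * of_bool (x \<in> base_polytope (M i))) = (0::int)"
    and L: "closed L" "convex L"
  shows "(\<Sum>i\<in>I. a i * of_bool (base_polytope (M i) \<inter> L \<noteq> {})) = 0"
proof (cases "I = {}")
  case False
  then have "finite E" using ground finite_ground by blast
  let ?S = "\<lambda>i. base_polytope (M i) \<inter> L"
  show ?thesis
  proof (rule sum_nonempty_convex_eq_0[OF \<open>finite I\<close> \<open>finite E\<close> bounded_linear_lookup])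
    fix i
    show "compact (?S i)" "convex (?S i)"
      using L finite_bases unfolding base_polytope_eq
      by (auto intro!: compact_Int_closed finite_imp_compact_convex_hull convex_Int)
  next
    fix y :: "nat \<Rightarrow> real"
    define p where "p = (\<Sum>e\<in>E. Poly_Mapping.single e (y e))"
    have p: "Poly_Mapping.lookup p e = (if e \<in> E then y e else 0)" for e
      using \<open>finite E\<close> by (simp add: p_def lookup_sum lookup_single when_def)
    then have "p \<in> coord_space E"
      by (auto simp: coord_space_def in_keys_iff split: if_splits)
    have "(\<exists>x\<in>?S i. \<forall>e\<in>E. Poly_Mapping.lookup x e = y e) \<longleftrightarrow> p \<in> ?S i" if "i \<in> I" for i
    proof -
      have eq: "x = p" if "x \<in> base_polytope (M i)" "\<forall>e\<in>E. Poly_Mapping.lookup x e = y e" for x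
      proof (rule poly_mapping_eqI)
        fix e
        have "x \<in> coord_space E"
          using base_polytope_subset_coord_space that ground[OF \<open>i \<in> I\<close>] by blast
        then show "Poly_Mapping.lookup x e = Poly_Mapping.lookup p e"
          using that p by (auto simp: coord_space_def in_keys_iff)
      qed
      show ?thesis
      proof
        assume "p \<in> ?S i"
        then show "\<exists>x\<in>?S i. \<forall>e\<in>E. Poly_Mapping.lookup x e = y e"
          by (intro bexI[of _ p]) (simp_all add: p)
      qed (use eq in blast)
    qed
    \<comment> \<open>Membership of \<open>p\<close> in \<open>L\<close> does not depend on
      \<open>i\<close> and factors out.\<close>
    then have "(\<Sum>i\<in>I. a i * of_bool (\<exists>x\<in>?S i. \<forall>e\<in>E. Poly_Mapping.lookup x e = y e))
        = (\<Sum>i\<in>I. a i * of_bool (p \<in> base_polytope (M i))) * of_bool (p \<in> L)"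
      by (simp add: sum_distrib_right of_bool_conj mult.assoc)
    then show "(\<Sum>i\<in>I. a i * of_bool (\<exists>x\<in>?S i. \<forall>e\<in>E. Poly_Mapping.lookup x e = y e)) = 0"
      using zero[OF \<open>p \<in> coord_space E\<close>] by simp
  qed
qed simp

text \<open>The bound \<open>\<delta>\<close> replaces strict positivity of the coordinates so that
  the region is closed.\<close>

definition test_region :: "nat set \<Rightarrow> nat set set \<Rightarrow> real \<Rightarrow> real \<Rightarrow> (nat \<Rightarrow>\<^sub>0 real) set" where
  "test_region E C \<delta> t
    = {x. (\<forall>e\<in>E. \<delta> \<le> Poly_Mapping.lookup x e) \<and> t \<le> weight_functional C x}"

lemma closed_test_region: "closed (test_region E C \<delta> t)"
proof -
  have "test_region E C \<delta> t = (\<Inter>e\<in>E. {x. \<delta> \<le> Poly_Mapping.lookup x e}) \<inter> {x. t \<le> weight_functional C x}"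
    by (auto simp: test_region_def)
  then show ?thesis
    by (simp add: closed_INT closed_Int closed_Collect_le linear_continuous_on
        bounded_linear_lookup bounded_linear_weight_functional)
qed

lemma convex_test_region: "convex (test_region E C \<delta> t)"
proof -
  have "convex {x. c \<le> h x}" if "linear h" for h :: "(nat \<Rightarrow>\<^sub>0 real) \<Rightarrow> real" and c
    using convex_linear_vimage[OF that convex_real_interval(1)[of c]] by (simp add: vimage_def)
  moreover have "test_region E C \<delta> t = (\<Inter>e\<in>E. {x. \<delta> \<le> Poly_Mapping.lookup x e}) \<inter> {x. t \<le> weight_functional C x}"
    by (auto simp: test_region_def)
  ultimately show ?thesis
    by (simp add: convex_INT convex_Int linear_lookup
        bounded_linear.linear[OF bounded_linear_weight_functional])
qed

text \<open>Mass \<open>1 - c\<close> is put on \<open>B\<close>, and mass \<open>c\<close> is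
  spread evenly over bases that together cover the ground set.\<close>

lemma base_polytope_positive_point:
  assumes "B \<in> bases M" "ground M \<noteq> {}" "0 \<le> c" "c \<le> 1"
    and f: "\<And>e. e \<in> ground M \<Longrightarrow> f e \<in> bases M \<and> e \<in> f e"
    and C: "\<And>F. F \<in> C \<Longrightarrow> finite F"
  defines "n \<equiv> real (card (ground M))"
  shows "\<exists>x\<in>base_polytope M. (\<forall>e\<in>ground M. c / n \<le> Poly_Mapping.lookup x e) \<and>
    weight_functional C x = (1 - c) * weight C B + c / n * (\<Sum>e\<in>ground M. weight C (f e))"
proof -
  let ?P = "base_polytope M"
  have n: "n > 0" using assms finite_ground by (simp add: card_gt_0_iff)
  define z where "z = (\<Sum>e\<in>ground M. (1 / n) *\<^sub>R basis_vector (f e))"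
  define x where "x = (1 - c) *\<^sub>R basis_vector B + c *\<^sub>R z"
  have vec: "basis_vector B' \<in> ?P" if "B' \<in> bases M" for B'
    using that by (simp add: base_polytope_eq hull_inc)
  have "z \<in> ?P"
    unfolding z_def
    by (rule convex_sum[OF finite_ground]) (use n f vec in \<open>auto simp: base_polytope_eq n_def\<close>)
  then have "x \<in> ?P"
    unfolding x_def using assms vec by (intro convexD) (auto simp: base_polytope_eq)
  have expand: "h x = (1 - c) * h (basis_vector B) + c / n * (\<Sum>e\<in>ground M. h (basis_vector (f e)))"
    if "linear h" for h :: "(nat \<Rightarrow>\<^sub>0 real) \<Rightarrow> real"
    unfolding x_def z_def using that
    by (simp add: linear_add linear_scale linear_sum sum_divide_distrib sum_distrib_left)
  show ?thesis
  proof (intro bexI[OF _ \<open>x \<in> ?P\<close>] conjI ballI)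
    fix e assume e: "e \<in> ground M"
    \<comment> \<open>The summand \<open>d = e\<close> alone contributes one, because
      \<open>e\<close> lies in \<open>f e\<close>.\<close>
    have "1 \<le> (\<Sum>d\<in>ground M. Poly_Mapping.lookup (basis_vector (f d)) e)"
      using member_le_sum[of e "ground M" "\<lambda>d. Poly_Mapping.lookup (basis_vector (f d)) e"]
        e f finite_basis[of _ M] finite_ground[of M] by (force simp: lookup_basis_vector)
    then have "c / n * 1 \<le> c / n * (\<Sum>d\<in>ground M. Poly_Mapping.lookup (basis_vector (f d)) e)"
      using assms n by (intro mult_left_mono) auto
    moreover have "0 \<le> (1 - c) * Poly_Mapping.lookup (basis_vector B) e"
      using assms finite_basis by (simp add: lookup_basis_vector)
    ultimately show "c / n \<le> Poly_Mapping.lookup x e"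
      unfolding expand[OF linear_lookup] by linarith
  next
    show "weight_functional C x = (1 - c) * weight C B + c / n * (\<Sum>e\<in>ground M. weight C (f e))"
    proof -
      have "weight_functional C (basis_vector B') = weight C B'" if "B' \<in> bases M" for B'
        using that C finite_basis by (intro weight_functional_basis_vector) auto
      then show ?thesis
        unfolding expand[OF bounded_linear.linear[OF bounded_linear_weight_functional]]
        using assms(1) f by simp
    qed
  qed
qed

lemma weight_le: "(\<And>F. F \<in> C \<Longrightarrow> finite F) \<Longrightarrow> weight C B \<le> (\<Sum>F\<in>C. card F)"
  unfolding weight_def by (intro sum_mono card_mono) auto

text \<open>The largest value of \<open>weight_functional C\<close> on the part of the base polytope where all
  coordinates are at least \<open>\<delta>\<close> is the maximal weight \<open>m\<close> of a basis if the initial matroid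
  is loopless, and lies in \<open>[m - 1/2, m)\<close> if only \<open>M\<close> itself is. Hence the differences below count
  whether this value is an integer.\<close>

lemma loopless_initial_eq_sum:
  assumes "ground M \<noteq> {}" and C: "\<And>F. F \<in> C \<Longrightarrow> finite F"
  defines "N \<equiv> \<Sum>F\<in>C. card F"
  defines "\<delta> \<equiv> 1 / (2 * (real N + 1)) / card (ground M)"
  shows "(of_bool (loopless_initial M C) :: int) = (\<Sum>k\<le>N.
      of_bool (base_polytope M \<inter> test_region (ground M) C \<delta> (real k) \<noteq> {})
    - of_bool (base_polytope M \<inter> test_region (ground M) C \<delta> (real k + 1/2) \<noteq> {}))"
proof -
  let ?g = "\<lambda>t. base_polytope M \<inter> test_region (ground M) C \<delta> t \<noteq> {}"
  \<comment> \<open>All weights are at most \<open>N\<close>, so moving mass \<open>c\<close> away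
    from a maximal basis costs at most 1/2.\<close>
  define c where "c = 1 / (2 * (real N + 1))"
  have c: "0 < c" "c \<le> 1" "c * N \<le> 1/2" by (auto simp: c_def field_simps)
  have \<delta>: "\<delta> = c / card (ground M)" "\<delta> > 0"
    using c assms finite_ground by (auto simp: \<delta>_def c_def card_gt_0_iff)
  obtain B where B: "B \<in> max_bases M C" using max_bases_nonempty by blast
  then have bas: "B \<in> bases M" by (simp add: max_bases_def)
  define m where "m = weight C B"
  have m_max: "weight C B' \<le> m" if "B' \<in> bases M" for B'
    using B that by (simp add: max_bases_def m_def)
  have "m \<le> N" unfolding m_def N_def using C by (rule weight_le)
  then have "c * m \<le> 1/2" using c by (smt (verit) mult_left_mono of_nat_mono)
  have wt: "weight_functional C (basis_vector B') = weight C B'" if "B' \<in> bases M" for B'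
    using that C finite_basis by (intro weight_functional_basis_vector) auto
  have g_mono: "?g t" if "?g s" "t \<le> s" for s t
    using that by (auto simp: test_region_def)
  have lin: "linear (weight_functional C)"
    by (rule bounded_linear.linear[OF bounded_linear_weight_functional])
  have g_le: "t \<le> m" if g: "?g t" for t
  proof -
    obtain x where x: "x \<in> base_polytope M" "t \<le> weight_functional C x"
      using g by (auto simp: test_region_def)
    then show ?thesis
      using linear_le_on_base_polytope[OF lin _ x(1), of m] m_max wt by fastforce
  qed
  show ?thesis
  proof (cases "loopless_initial M C")
    case True
    \<comment> \<open>Here the covering bases can themselves be chosen of maximal weight, so the
      shifted point loses no weight.\<close>
    then obtain f where f: "\<And>e. e \<in> ground M \<Longrightarrow> f e \<in> max_bases M C \<and> e \<in> f e"
      unfolding loopless_initial_def by metis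
    then have fm: "f e \<in> bases M" "weight C (f e) = m" if "e \<in> ground M" for e
      using that m_max B bas by (auto simp: max_bases_def m_def intro: antisym)
    have f': "f e \<in> bases M \<and> e \<in> f e" if "e \<in> ground M" for e
      using f fm that by blast
    obtain x where x: "x \<in> base_polytope M" "\<forall>e\<in>ground M. \<delta> \<le> Poly_Mapping.lookup x e"
      "weight_functional C x = (1 - c) * weight C B
         + c / card (ground M) * (\<Sum>e\<in>ground M. weight C (f e))"
      using base_polytope_positive_point[OF bas assms(1) _ _ f' C, of c] c \<delta> by auto
    have "weight_functional C x = m"
      using x(3) fm assms(1) finite_ground by (simp add: m_def[symmetric] field_simps)
    then have "?g m" using x by (auto simp: test_region_def)
    then have g: "?g t \<longleftrightarrow> t \<le> m" for t using g_le g_mono by blast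
    \<comment> \<open>The threshold \<open>k + 1/2\<close> is reached only for \<open>k < m\<close>,
      the threshold \<open>k\<close> also for \<open>k = m\<close>.\<close>
    have "of_bool (?g (real k)) - of_bool (?g (real k + 1/2)) = (of_bool (k = m) :: int)" for k
    proof -
      have "?g (real k) \<longleftrightarrow> k \<le> m" "?g (real k + 1/2) \<longleftrightarrow> k < m"
        unfolding g by linarith+
      then show ?thesis by (simp only:) auto
    qed
    then have "(\<Sum>k\<le>N. of_bool (?g (real k)) - of_bool (?g (real k + 1/2)))
        = (\<Sum>k\<le>N. if k = m then 1 else (0::int))"
      by (simp only: of_bool_def)
    then show ?thesis using True \<open>m \<le> N\<close> by simp
  next
    case False
    then obtain e where e: "e \<in> ground M" "\<And>B'. B' \<in> max_bases M C \<Longrightarrow> e \<notin> B'"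
      by (auto simp: loopless_initial_def)
    have not_g: "\<not> ?g (real m)"
    proof
      assume "?g (real m)"
      then obtain x where x: "x \<in> base_polytope M" "m \<le> weight_functional C x"
          "\<delta> \<le> Poly_Mapping.lookup x e"
        using e(1) by (auto simp: test_region_def)
      \<comment> \<open>Weights are integers and no basis of weight \<open>m\<close> contains
        \<open>e\<close>, so a basis through \<open>e\<close> has weight at most
        \<open>m - 1\<close>. A positive coordinate at \<open>e\<close> therefore forces weight
        below \<open>m\<close>.\<close>
      have "weight_functional C x + Poly_Mapping.lookup x e \<le> m"
      proof (rule linear_le_on_base_polytope[OF _ _ x(1)])
        show "linear (\<lambda>x. weight_functional C x + Poly_Mapping.lookup x e)"
          by (intro linear_compose_add lin linear_lookup)
        fix B' assume B': "B' \<in> bases M"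
        have "weight C B' + of_bool (e \<in> B') \<le> m"
          using e(2)[of B'] B' m_max by (force simp: max_bases_def)
        then have "real (weight C B' + of_bool (e \<in> B')) \<le> real m" by (rule of_nat_mono)
        then show "weight_functional C (basis_vector B')
            + Poly_Mapping.lookup (basis_vector B') e \<le> m"
          using B' wt finite_basis by (simp add: lookup_basis_vector)
      qed
      then show False using x \<delta> by linarith
    qed
    \<comment> \<open>No threshold separates the two tests: in the loopless case both succeed for
      \<open>k < m\<close> and both fail from \<open>m\<close> on.\<close>
    have "?g (real k) \<longleftrightarrow> ?g (real k + 1/2)" for k
    proof (cases "loopless M")
      case True
      then have "\<forall>e\<in>ground M. \<exists>B. B \<in> bases M \<and> e \<in> B"
        by (auto simp: loopless_def indep_def)
      then obtain f where f: "\<And>e. e \<in> ground M \<Longrightarrow> f e \<in> bases M \<and> e \<in> f e"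
        by metis
      obtain x where x: "x \<in> base_polytope M" "\<forall>e\<in>ground M. \<delta> \<le> Poly_Mapping.lookup x e"
        "weight_functional C x = (1 - c) * weight C B
           + c / card (ground M) * (\<Sum>e\<in>ground M. weight C (f e))"
        using base_polytope_positive_point[OF bas assms(1) _ _ f C, of c] c \<delta> by auto
      have "0 \<le> c / card (ground M) * (\<Sum>e\<in>ground M. weight C (f e))"
        using c(1) by (intro mult_nonneg_nonneg divide_nonneg_nonneg) (simp_all add: sum_nonneg)
      then have "real m - 1/2 \<le> weight_functional C x"
        using x(3) \<open>c * m \<le> 1/2\<close> by (simp add: m_def[symmetric] algebra_simps)
      then have half: "?g (real m - 1/2)" using x by (auto simp: test_region_def)
      show ?thesis
      proof (cases "k < m")
        case True
        then have "real k + 1/2 \<le> real m - 1/2" by linarith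
        then have "?g (real k + 1/2)" by (rule g_mono[OF half])
        moreover have "?g (real k)" by (rule g_mono[OF calculation]) simp
        ultimately show ?thesis by blast
      next
        case False
        then have "\<not> ?g (real k)" using g_mono[of "real k" "real m"] not_g by auto
        moreover have "\<not> ?g (real k + 1/2)"
          using g_mono[of "real k + 1/2" "real k"] calculation by auto
        ultimately show ?thesis by blast
      qed
    next
      case False
      \<comment> \<open>The coordinate of a loop vanishes on the whole polytope, which thus misses
        every test region.\<close>
      then obtain d where d: "d \<in> ground M" "\<And>B'. B' \<in> bases M \<Longrightarrow> d \<notin> B'"
        by (auto simp: loopless_def indep_def)
      have "\<not> ?g t" for t
      proof
        assume "?g t"
        then obtain x where "x \<in> base_polytope M" "\<delta> \<le> Poly_Mapping.lookup x d"
          using d(1) by (auto simp: test_region_def)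
        then show False using lookup_base_polytope_eq_0[OF _ d(2)] \<delta> by fastforce
      qed
      then show ?thesis by blast
    qed
    then show ?thesis using False by (simp only:) simp
  qed
qed

text \<open>\<open>N\<close> and \<open>\<delta>\<close> depend only on \<open>C\<close> and
  \<open>E\<close>, so the same test regions serve all the matroids of the relation.\<close>

lemma sum_loopless_initial_eq_0:
  assumes "finite I" and ground: "\<And>i. i \<in> I \<Longrightarrow> ground (M i) = E" and "E \<noteq> {}"
    and zero: "\<And>x. x \<in> coord_space E \<Longrightarrow> (\<Sum>i\<in>I. a i * of_bool (x \<in> base_polytope (M i))) = (0::int)"
    and C: "\<And>F. F \<in> C \<Longrightarrow> finite F"
  shows "(\<Sum>i\<in>I. a i * of_bool (loopless_initial (M i) C)) = 0"
proof -
  define N where "N = (\<Sum>F\<in>C. card F)"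
  define \<delta> where "\<delta> = 1 / (2 * (real N + 1)) / card E"
  let ?g = "\<lambda>t i. of_bool (base_polytope (M i) \<inter> test_region E C \<delta> t \<noteq> {}) :: int"
  have "(\<Sum>i\<in>I. a i * of_bool (loopless_initial (M i) C))
      = (\<Sum>i\<in>I. a i * (\<Sum>k\<le>N. ?g (real k) i - ?g (real k + 1/2) i))"
  proof (rule sum.cong[OF refl])
    fix i assume i: "i \<in> I"
    show "a i * of_bool (loopless_initial (M i) C) = a i * (\<Sum>k\<le>N. ?g (real k) i - ?g (real k + 1/2) i)"
      using loopless_initial_eq_sum[of "M i" C] C
      unfolding ground[OF i] N_def[symmetric] \<delta>_def[symmetric] using \<open>E \<noteq> {}\<close> by simp
  qed
  also have "\<dots> = (\<Sum>k\<le>N. (\<Sum>i\<in>I. a i * ?g (real k) i) - (\<Sum>i\<in>I. a i * ?g (real k + 1/2) i))"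
    unfolding sum_distrib_left by (subst sum.swap) (simp add: right_diff_distrib sum_subtractf)
  also have "\<dots> = 0"
    using sum_meets_base_polytope_eq_0[OF assms(1,2) zero closed_test_region convex_test_region]
    by simp
  finally show ?thesis .
qed

section \<open>The chain polynomial\<close>

text \<open>A maximal superset of \<open>X\<close> of the same rank is a flat; it plays the role of
  the closure of \<open>X\<close>.\<close>

lemma flat_of_equal_rank:
  assumes "X \<subseteq> ground M"
  shows "\<exists>G\<in>flats M. X \<subseteq> G \<and> matroid_rank M G = matroid_rank M X"
proof -
  let ?A = "{G. G \<subseteq> ground M \<and> matroid_rank M G = matroid_rank M X}"
  have "finite ?A" by (rule finite_subset[of _ "Pow (ground M)"]) (use finite_ground in auto)
  then obtain G where G: "G \<in> ?A" "X \<subseteq> G" and max: "\<forall>H\<in>?A. G \<subseteq> H \<longrightarrow> G = H"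
    using finite_has_maximal2[of ?A X] assms by auto
  have "matroid_rank M G < matroid_rank M (insert y G)" if "y \<in> ground M - G" for y
  proof -
    have "insert y G \<notin> ?A" using max that by blast
    then have "matroid_rank M (insert y G) \<noteq> matroid_rank M G" using G that by auto
    moreover have "matroid_rank M G \<le> matroid_rank M (insert y G)" by (rule rank_mono) auto
    ultimately show ?thesis by simp
  qed
  then have "G \<in> flats M" using G by (auto simp: flats_def)
  then show ?thesis using G by auto
qed

text \<open>With \<open>j\<close> one below the rank this gives a face of the largest possible size.
  The flat \<open>F\<close> above the chain is carried along to be enlarged in the next
  step.\<close>

lemma long_chain_of_proper_flats:
  assumes "j < matroid_rank M (ground M)"
  shows "\<exists>C F. subset.chain (proper_flats M) C \<and> finite C \<and> card C = j \<and>
    F \<in> flats M \<and> matroid_rank M F = j \<and> (\<forall>G\<in>C. G \<subseteq> F)"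
  using assms
proof (induction j)
  case 0
  have "matroid_rank M {} = 0" using rank_attained[of "{}" M] by auto
  \<comment> \<open>\<open>F\<close> may be empty here, and it is not put into the chain.\<close>
  then obtain F where "F \<in> flats M" "matroid_rank M F = 0"
    using flat_of_equal_rank[of "{}" M] by auto
  then show ?case by (intro exI[of _ "{}"] exI[of _ F]) (simp add: subset.chain_def)
next
  case (Suc j)
  then obtain C F where C: "subset.chain (proper_flats M) C" "finite C" "card C = j" "\<forall>G\<in>C. G \<subseteq> F"
    and F: "F \<in> flats M" "matroid_rank M F = j"
    by (meson Suc_lessD)
  then have "F \<noteq> ground M" using Suc.prems by auto
  then obtain x where x: "x \<in> ground M - F" using F(1) by (auto simp: flats_def)
  then have "matroid_rank M F < matroid_rank M (insert x F)" using F(1) by (simp add: flats_def)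
  then have "matroid_rank M (insert x F) = Suc j"
    using F(2) rank_insert_le[of M x F] by linarith
  moreover have "insert x F \<subseteq> ground M" using F(1) x by (simp add: flats_def)
  ultimately obtain G where G: "G \<in> flats M" "insert x F \<subseteq> G" "matroid_rank M G = Suc j"
    using flat_of_equal_rank by metis
  then have "G \<in> proper_flats M" using Suc.prems by (auto simp: proper_flats_def)
  moreover have "G \<notin> C" using C(4) G(2) x by blast
  moreover have sub: "\<forall>H\<in>C. H \<subseteq> G" using C(4) G(2) by blast
  ultimately have "subset.chain (proper_flats M) (insert G C)" "card (insert G C) = Suc j"
    using C by (auto simp: subset_chain_insert)
  then show ?case using G sub C(2) by (intro exI[of _ "insert G C"] exI[of _ G]) auto
qed

lemma finite_order_complex: "finite P \<Longrightarrow> finite (order_complex P)"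
  by (rule finite_subset[of _ "Pow P"]) (auto simp: order_complex_def subset.chain_def)

lemma finite_proper_flats: "finite (proper_flats M)"
  by (rule finite_subset[of _ "Pow (ground M)"])
    (use finite_ground in \<open>auto simp: proper_flats_def flats_def\<close>)

text \<open>Rank is injective on a chain of flats, and looplessness makes the empty set a flat, so
  the ranks lie strictly between 0 and the rank of the matroid.\<close>

lemma card_chain_proper_flats_less:
  assumes "loopless M" "ground M \<noteq> {}" and C: "C \<in> order_complex (proper_flats M)"
  shows "card C < matroid_rank M (ground M)"
proof -
  let ?r = "matroid_rank M"
  have chain: "subset.chain (proper_flats M) C" "finite C"
    using C by (auto simp: order_complex_def)
  have "matroid_rank M {} = 0" using rank_attained[of "{}" M] by auto
  moreover have "0 < ?r {x}" if "x \<in> ground M" for x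
    using card_le_rank[of "{x}" "{x}" M] assms(1) that by (simp add: loopless_def)
  ultimately have empty: "{} \<in> flats M" by (simp add: flats_def)
  have flat: "F \<in> flats M" "F \<subseteq> ground M" "F \<noteq> {}" "F \<noteq> ground M" if "F \<in> C" for F
    using that chain by (auto simp: subset.chain_def proper_flats_def flats_def)
  have "?r ` C \<subseteq> {0<..<?r (ground M)}"
  proof clarify
    fix F assume F: "F \<in> C"
    have "?r {} < ?r F" using rank_flat_less[OF empty flat(2)[OF F]] flat(3)[OF F] by blast
    moreover have "?r F < ?r (ground M)"
      using rank_flat_less[OF flat(1)[OF F] order_refl] flat[OF F] by blast
    ultimately show "?r F \<in> {0<..<?r (ground M)}" by simp
  qed
  moreover have "inj_on ?r C"
  proof (rule inj_onI, rule ccontr)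
    fix F G assume FG: "F \<in> C" "G \<in> C" "?r F = ?r G" "F \<noteq> G"
    then have "F \<subset> G \<or> G \<subset> F" using chain(1) by (auto simp: subset.chain_def)
    then show False using rank_flat_less flat FG by (metis less_irrefl)
  qed
  ultimately have "card C \<le> card {0<..<?r (ground M)}"
    by (metis card_image card_mono finite_greaterThanLessThan)
  moreover obtain x where "x \<in> ground M" using assms(2) by blast
  then have "0 < ?r (ground M)"
    using card_le_rank[of "{x}" "ground M" M] assms(1) by (simp add: loopless_def)
  ultimately show ?thesis by simp
qed

text \<open>The largest faces have size one less than the rank, which fixes the degree; the faces
  are then grouped by size.\<close>

lemma chain_polynomial_eq_sum:
  assumes "loopless M" "ground M \<noteq> {}"
  shows "chain_polynomial M = (\<Sum>C\<in>order_complex (proper_flats M).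
    monom 1 (matroid_rank M (ground M) - 1 - card C))"
proof -
  let ?\<Delta> = "order_complex (proper_flats M)" and ?r = "matroid_rank M (ground M)"
  have fin: "finite ?\<Delta>" by (intro finite_order_complex finite_proper_flats)
  have "{} \<in> ?\<Delta>" by (simp add: order_complex_def subset.chain_def)
  then have "0 < ?r" using card_chain_proper_flats_less[OF assms] by fastforce
  have less: "card C \<le> ?r - 1" if "C \<in> ?\<Delta>" for C
    using card_chain_proper_flats_less[OF assms that] by simp
  obtain C where "C \<in> ?\<Delta>" "card C = ?r - 1"
    using long_chain_of_proper_flats[of "?r - 1" M] \<open>0 < ?r\<close> by (auto simp: order_complex_def)
  then have d: "Max (card ` ?\<Delta>) = ?r - 1"
    using fin less by (intro Max_eqI) force+
  have "monom (int (f_number ?\<Delta> i)) (?r - 1 - i)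
      = (\<Sum>C\<in>{C \<in> ?\<Delta>. card C = i}. monom 1 (?r - 1 - card C))" for i
    by (simp add: f_number_def of_nat_poly smult_monom)
  then have "chain_polynomial M
      = (\<Sum>i\<le>?r - 1. \<Sum>C\<in>{C \<in> ?\<Delta>. card C = i}. monom 1 (?r - 1 - card C))"
    by (simp add: chain_polynomial_def f_polynomial_def d)
  also have "\<dots> = (\<Sum>C\<in>?\<Delta>. monom 1 (?r - 1 - card C))"
    using fin less by (intro sum.group) auto
  finally show ?thesis .
qed

text \<open>The chains now range over a set that depends only on the ground set, so this sum can be
  exchanged with a sum over matroids on that set.\<close>

lemma chain_polynomial_eq_sum_loopless_initial:
  assumes "ground M \<noteq> {}"
  shows "(if loopless M then chain_polynomial M else 0)
    = (\<Sum>C | subset.chain (Pow (ground M) - {{}, ground M}) C.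
        of_bool (loopless_initial M C) * monom 1 (matroid_rank M (ground M) - 1 - card C))"
    (is "_ = (\<Sum>C\<in>?\<C>. _)")
proof -
  have fin: "finite C" "finite ?\<C>" if "C \<in> ?\<C>" for C
  proof -
    have "?\<C> \<subseteq> Pow (Pow (ground M))" by (auto simp: subset.chain_def)
    then show "finite C" "finite ?\<C>"
      using that finite_ground[of M] by (auto intro: finite_subset)
  qed
  have ini: "loopless_initial M C \<longleftrightarrow> loopless M \<and> C \<subseteq> flats M" if "C \<in> ?\<C>" for C
    using that fin(1)[OF that] by (intro loopless_initial_iff) (auto simp: subset.chain_def)
  show ?thesis
  proof (cases "loopless M")
    case True
    have "flats M \<subseteq> Pow (ground M)" by (auto simp: flats_def)
    then have flat: "proper_flats M \<subseteq> Pow (ground M) - {{}, ground M}" "proper_flats M \<subseteq> flats M"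
      and proper: "(Pow (ground M) - {{}, ground M}) \<inter> flats M \<subseteq> proper_flats M"
      unfolding proper_flats_def by blast+
    have eq: "{C \<in> ?\<C>. loopless_initial M C} = order_complex (proper_flats M)"
    proof (intro set_eqI iffI)
      fix C assume "C \<in> {C \<in> ?\<C>. loopless_initial M C}"
      then have C: "C \<in> ?\<C>" "C \<subseteq> flats M" "finite C" using ini fin(1) by blast+
      from C(1) have "C \<subseteq> Pow (ground M) - {{}, ground M}" by (simp add: subset.chain_def)
      then have "C \<subseteq> proper_flats M" using C(2) proper by (meson Int_greatest subset_trans)
      then show "C \<in> order_complex (proper_flats M)"
        using C by (simp add: order_complex_def subset.chain_def)
    next
      fix C assume "C \<in> order_complex (proper_flats M)"
      then have C: "subset.chain (proper_flats M) C" "C \<subseteq> proper_flats M"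
        by (simp_all add: order_complex_def subset.chain_def)
      have "C \<subseteq> Pow (ground M) - {{}, ground M}" using C(2) flat(1) by (rule subset_trans)
      then have "C \<in> ?\<C>" using C(1) by (simp add: subset.chain_def)
      moreover have "loopless_initial M C" using ini[OF calculation] True C(2) flat(2) by blast
      ultimately show "C \<in> {C \<in> ?\<C>. loopless_initial M C}" by blast
    qed
    have "finite ?\<C>" using fin(2)[of "{}"] by (simp add: subset.chain_def)
    then have "(\<Sum>C\<in>?\<C>. of_bool (loopless_initial M C) * monom 1 (matroid_rank M (ground M) - 1 - card C))
        = (\<Sum>C\<in>{C \<in> ?\<C>. loopless_initial M C}. monom (1::int) (matroid_rank M (ground M) - 1 - card C))"
      by (intro sum.mono_neutral_cong_right) auto
    then show ?thesis using True assms unfolding eq by (simp add: chain_polynomial_eq_sum)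
  qed (simp add: ini)
qed

text \<open>The exponent depends on the rank, so for each chain the relation is split into rank
  classes, and the coefficient sum of every class vanishes.\<close>

lemma valuation_chain_polynomial:
  "valuation (\<lambda>M. if loopless M \<and> ground M \<noteq> {} then chain_polynomial M else 0)"
  unfolding valuation_def
proof (intro allI impI)
  fix E s and M :: "nat \<Rightarrow> matroid" and a :: "nat \<Rightarrow> int"
  assume ground: "\<forall>i\<in>{1..s}. ground (M i) = E"
    and zero: "\<forall>x\<in>coord_space E. (\<Sum>i=1..s. a i * indicator (base_polytope (M i)) x) = 0"
  let ?f = "\<lambda>M. if loopless M \<and> ground M \<noteq> {} then chain_polynomial M else 0"
  define r where "r i = matroid_rank (M i) E" for i
  show "(\<Sum>i=1..s. int_scale (a i) (?f (M i))) = 0"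
  proof (cases "E = {}")
    case True
    then show ?thesis using ground by (auto simp: int_scale_ring intro!: sum.neutral)
  next
    case False
    let ?\<C> = "{C. subset.chain (Pow E - {{}, E}) C}"
    have initial_zero: "(\<Sum>i | i \<in> {1..s} \<and> r i = \<rho>. a i * of_bool (loopless_initial (M i) C)) = 0"
      if "C \<in> ?\<C>" "s > 0" for \<rho> C
    proof -
      let ?I = "{i. i \<in> {1..s} \<and> r i = \<rho>}"
      have "finite E" using ground that(2) finite_ground[of "M 1"] by simp
      then have finC: "finite F" if "F \<in> C" for F
        using that \<open>C \<in> ?\<C>\<close> by (auto simp: subset.chain_def intro: finite_subset)
      \<comment> \<open>A point lies only in polytopes whose rank is its coordinate sum. Hence the
        sum over the class is either the full sum or has only zero terms.\<close>
      have zeroI: "(\<Sum>i\<in>?I. a i * of_bool (x \<in> base_polytope (M i))) = 0"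
        if x: "x \<in> coord_space E" for x
      proof -
        have "(\<Sum>e\<in>E. Poly_Mapping.lookup x e) = r i"
          if "i \<in> {1..s}" "x \<in> base_polytope (M i)" for i
          using sum_lookup_base_polytope[of x "M i"] ground that by (simp add: r_def)
        then have "(\<Sum>i\<in>?I. a i * of_bool (x \<in> base_polytope (M i)))
            = (\<Sum>i=1..s. a i * indicator (base_polytope (M i)) x)
              * of_bool ((\<Sum>e\<in>E. Poly_Mapping.lookup x e) = real \<rho>)"
          unfolding sum_distrib_right
          by (intro sum.mono_neutral_cong_left) (auto simp: indicator_def)
        then show ?thesis using zero x by simp
      qed
      show ?thesis
        by (rule sum_loopless_initial_eq_0[OF _ _ False zeroI finC]) (use ground in auto)
    qed
    have "(\<Sum>i=1..s. int_scale (a i) (?f (M i)))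
        = (\<Sum>i=1..s. \<Sum>C\<in>?\<C>. of_int (a i * of_bool (loopless_initial (M i) C)) * monom 1 (r i - 1 - card C))"
    proof (rule sum.cong[OF refl])
      fix i assume i: "i \<in> {1..s}"
      show "int_scale (a i) (?f (M i))
        = (\<Sum>C\<in>?\<C>. of_int (a i * of_bool (loopless_initial (M i) C)) * monom 1 (r i - 1 - card C))"
        using chain_polynomial_eq_sum_loopless_initial[of "M i"] ground i False
        by (simp add: int_scale_ring r_def sum_distrib_left mult.assoc)
    qed
    also have "\<dots> = (\<Sum>C\<in>?\<C>. \<Sum>i=1..s.
        of_int (a i * of_bool (loopless_initial (M i) C)) * monom 1 (r i - 1 - card C))"
      by (rule sum.swap)
    also have "\<dots> = 0"
    proof (rule sum.neutral, rule ballI)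
      fix C assume C: "C \<in> ?\<C>"
      let ?h = "\<lambda>i. of_int (a i * of_bool (loopless_initial (M i) C)) * monom (1::int) (r i - 1 - card C)"
      have "(\<Sum>i | i \<in> {1..s} \<and> r i = \<rho>. ?h i) = 0" for \<rho>
      proof (cases "s = 0")
        case False
        then have "s > 0" by simp
        \<comment> \<open>Within a rank class the monomial is constant and factors out.\<close>
        have "(\<Sum>i | i \<in> {1..s} \<and> r i = \<rho>. ?h i)
            = of_int (\<Sum>i | i \<in> {1..s} \<and> r i = \<rho>. a i * of_bool (loopless_initial (M i) C))
              * monom 1 (\<rho> - 1 - card C)"
          unfolding of_int_sum sum_distrib_right by (rule sum.cong) auto
        then show ?thesis by (simp only: initial_zero[OF C \<open>s > 0\<close>] of_int_0 mult_zero_left)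
      qed simp
      moreover have "(\<Sum>i=1..s. ?h i) = (\<Sum>\<rho>\<in>r ` {1..s}. \<Sum>i | i \<in> {1..s} \<and> r i = \<rho>. ?h i)"
        by (rule sum.image_gen) simp
      ultimately show "(\<Sum>i=1..s. ?h i) = 0" by simp
    qed
    finally show ?thesis .
  qed
qed

section \<open>Invariance under isomorphism\<close>

text \<open>The inverse is kept explicit to make the notion symmetric, so that each one-sided
  statement also yields its converse.\<close>

definition iso_pair :: "(nat \<Rightarrow> nat) \<Rightarrow> (nat \<Rightarrow> nat) \<Rightarrow> matroid \<Rightarrow> matroid \<Rightarrow> bool" where
  "iso_pair \<phi> \<psi> M N \<longleftrightarrow>
    (\<forall>x\<in>ground M. \<phi> x \<in> ground N \<and> \<psi> (\<phi> x) = x) \<and>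
    (\<forall>y\<in>ground N. \<psi> y \<in> ground M \<and> \<phi> (\<psi> y) = y) \<and>
    (\<forall>B\<in>bases M. \<phi> ` B \<in> bases N) \<and> (\<forall>B\<in>bases N. \<psi> ` B \<in> bases M)"

lemma iso_pair_sym: "iso_pair \<phi> \<psi> M N \<Longrightarrow> iso_pair \<psi> \<phi> N M"
  by (auto simp: iso_pair_def)

lemma matroid_iso_imp_iso_pair:
  assumes "matroid_iso M N"
  shows "\<exists>\<phi> \<psi>. iso_pair \<phi> \<psi> M N"
proof -
  obtain \<phi> where \<phi>: "bij_betw \<phi> (ground M) (ground N)" "bases N = (\<lambda>B. \<phi> ` B) ` bases M"
    using assms by (auto simp: matroid_iso_def)
  define \<psi> where "\<psi> = inv_into (ground M) \<phi>"
  have inv: "\<psi> (\<phi> x) = x" if "x \<in> ground M" for x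
    using \<phi>(1) that by (simp add: \<psi>_def bij_betw_inv_into_left)
  have "\<psi> ` \<phi> ` B = B" if "B \<in> bases M" for B
    using inv bases_subset_ground[OF that] by (force simp: image_iff)
  moreover have "\<psi> y \<in> ground M" "\<phi> (\<psi> y) = y" if "y \<in> ground N" for y
    using \<phi>(1) that by (auto simp: \<psi>_def bij_betw_def inv_into_into f_inv_into_f)
  ultimately have "iso_pair \<phi> \<psi> M N"
    using \<phi> inv by (auto simp: iso_pair_def bij_betw_def)
  then show ?thesis by blast
qed

lemma iso_pair_image_inverse: "iso_pair \<phi> \<psi> M N \<Longrightarrow> X \<subseteq> ground M \<Longrightarrow> \<psi> ` \<phi> ` X = X"
  by (force simp: iso_pair_def image_iff)

lemma iso_pair_image_subset: "iso_pair \<phi> \<psi> M N \<Longrightarrow> X \<subseteq> ground M \<Longrightarrow> \<phi> ` X \<subseteq> ground N"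
  by (auto simp: iso_pair_def)

lemma iso_pair_image_ground: "iso_pair \<phi> \<psi> M N \<Longrightarrow> \<phi> ` ground M = ground N"
  by (metis iso_pair_image_inverse iso_pair_image_subset iso_pair_sym image_mono order_refl subset_antisym)

lemma iso_pair_inj_on: "iso_pair \<phi> \<psi> M N \<Longrightarrow> inj_on \<phi> (ground M)"
  by (rule inj_on_inverseI) (auto simp: iso_pair_def)

lemma iso_pair_indep: "iso_pair \<phi> \<psi> M N \<Longrightarrow> indep M I \<Longrightarrow> indep N (\<phi> ` I)"
  unfolding iso_pair_def indep_def by (meson image_mono)

lemma iso_pair_rank_le:
  assumes iso: "iso_pair \<phi> \<psi> M N"
  shows "matroid_rank M X \<le> matroid_rank N (\<phi> ` X)"
proof -
  obtain I where I: "I \<subseteq> X" "indep M I" "card I = matroid_rank M X"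
    using rank_attained by blast
  have "card (\<phi> ` I) = card I"
    using iso_pair_inj_on[OF iso] indep_subset_ground[OF I(2)] by (meson card_image inj_on_subset)
  moreover have "card (\<phi> ` I) \<le> matroid_rank N (\<phi> ` X)"
    using I iso_pair_indep[OF iso] by (intro card_le_rank) auto
  ultimately show ?thesis using I by simp
qed

lemma iso_pair_rank:
  assumes iso: "iso_pair \<phi> \<psi> M N" and "X \<subseteq> ground M"
  shows "matroid_rank N (\<phi> ` X) = matroid_rank M X"
  using iso_pair_rank_le[OF iso, of X] iso_pair_rank_le[OF iso_pair_sym[OF iso], of "\<phi> ` X"]
    iso_pair_image_inverse[OF assms] by simp

lemma iso_pair_flat:
  assumes iso: "iso_pair \<phi> \<psi> M N" and F: "F \<in> flats M"
  shows "\<phi> ` F \<in> flats N"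
  unfolding flats_def
proof (intro CollectI conjI ballI)
  have sub: "F \<subseteq> ground M" using F by (simp add: flats_def)
  show "\<phi> ` F \<subseteq> ground N" by (rule iso_pair_image_subset[OF iso sub])
  fix y assume y: "y \<in> ground N - \<phi> ` F"
  define x where "x = \<psi> y"
  have x: "x \<in> ground M" "y = \<phi> x" using iso y by (auto simp: iso_pair_def x_def)
  then have "x \<in> ground M - F" using y by auto
  then have "matroid_rank M F < matroid_rank M (insert x F)" using F by (simp add: flats_def)
  moreover have "insert y (\<phi> ` F) = \<phi> ` insert x F" using x by simp
  ultimately show "matroid_rank N (\<phi> ` F) < matroid_rank N (insert y (\<phi> ` F))"
    using iso_pair_rank[OF iso] sub x(1) by (metis insert_subset)
qed

lemma iso_pair_loopless:
  assumes iso: "iso_pair \<phi> \<psi> M N" and "loopless M"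
  shows "loopless N"
  unfolding loopless_def
proof
  fix y assume "y \<in> ground N"
  then have "\<psi> y \<in> ground M" "\<phi> (\<psi> y) = y" using iso by (auto simp: iso_pair_def)
  then show "indep N {y}"
    using iso_pair_indep[OF iso, of "{\<psi> y}"] assms(2) by (auto simp: loopless_def)
qed

lemma iso_pair_proper_flat:
  assumes iso: "iso_pair \<phi> \<psi> M N" and F: "F \<in> proper_flats M"
  shows "\<phi> ` F \<in> proper_flats N"
proof -
  have "F \<subseteq> ground M" using F by (simp add: proper_flats_def flats_def)
  then have "\<psi> ` \<phi> ` F = F" by (rule iso_pair_image_inverse[OF iso])
  moreover have "F \<noteq> ground M" using F by (simp add: proper_flats_def)
  ultimately have "\<phi> ` F \<noteq> ground N"
    using iso_pair_image_ground[OF iso_pair_sym[OF iso]] by metis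
  then show ?thesis using F iso_pair_flat[OF iso] by (auto simp: proper_flats_def)
qed

text \<open>Applied in both directions, the two parts show that taking images is a bijection between
  the order complexes.\<close>

lemma iso_pair_order_complex:
  assumes iso: "iso_pair \<phi> \<psi> M N" and C: "C \<in> order_complex (proper_flats M)"
  shows "(`) \<phi> ` C \<in> order_complex (proper_flats N)"
    and "(`) \<psi> ` (`) \<phi> ` C = C"
proof -
  show "(`) \<phi> ` C \<in> order_complex (proper_flats N)"
    unfolding order_complex_def subset.chain_def
  proof (intro CollectI conjI ballI)
    show "finite ((`) \<phi> ` C)" using C by (simp add: order_complex_def)
    show "(`) \<phi> ` C \<subseteq> proper_flats N"
      using C iso_pair_proper_flat[OF iso] by (auto simp: order_complex_def subset.chain_def)
    fix F' G' assume "F' \<in> (`) \<phi> ` C" "G' \<in> (`) \<phi> ` C"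
    then obtain F G where "F \<in> C" "G \<in> C" "F' = \<phi> ` F" "G' = \<phi> ` G" by blast
    moreover from this have "F \<subseteq> G \<or> G \<subseteq> F"
      using C by (auto simp: order_complex_def subset.chain_def)
    ultimately have "F' \<subseteq> G' \<or> G' \<subseteq> F'" by (metis image_mono)
    then show "(\<subset>)\<^sup>=\<^sup>= F' G' \<or> (\<subset>)\<^sup>=\<^sup>= G' F'" by auto
  qed
  have "F \<subseteq> ground M" if "F \<in> C" for F
    using C that by (auto simp: order_complex_def subset.chain_def proper_flats_def flats_def)
  then have "\<psi> ` \<phi> ` F = F" if "F \<in> C" for F
    using iso_pair_image_inverse[OF iso] that by blast
  then show "(`) \<psi> ` (`) \<phi> ` C = C" by (simp add: image_image cong: image_cong_simp)
qed

lemma iso_pair_chain_polynomial: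
  assumes iso: "iso_pair \<phi> \<psi> M N" and M: "loopless M" "ground M \<noteq> {}"
  shows "chain_polynomial M = chain_polynomial N"
proof -
  note inv = iso_pair_sym[OF iso]
  have N: "loopless N" "ground N \<noteq> {}"
    using iso_pair_loopless[OF iso M(1)] iso_pair_image_ground[OF iso] M(2) by auto
  have rank: "matroid_rank N (ground N) = matroid_rank M (ground M)"
    using iso_pair_rank[OF iso order_refl] iso_pair_image_ground[OF iso] by simp
  \<comment> \<open>Images do not increase cardinality, and \<open>C\<close> is itself an image of
    its image.\<close>
  have card: "card ((`) \<phi> ` C) = card C" if "C \<in> order_complex (proper_flats M)" for C
    using iso_pair_order_complex[OF iso that] that card_image_le
    by (metis (no_types, lifting) antisym finite_imageI mem_Collect_eq order_complex_def)
  show ?thesis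
    unfolding chain_polynomial_eq_sum[OF M] chain_polynomial_eq_sum[OF N]
    by (rule sum.reindex_bij_witness[where i = "image (image \<psi>)" and j = "image (image \<phi>)"])
      (simp_all add: iso_pair_order_complex[OF iso] iso_pair_order_complex[OF inv] card rank)
qed

theorem corollary8p8:
  shows "valuative_invariant
    (\<lambda>M. if loopless M \<and> ground M \<noteq> {} then chain_polynomial M else 0)"
  unfolding valuative_invariant_def
proof (intro conjI allI impI valuation_chain_polynomial)
  fix M N assume "matroid_iso M N"
  then obtain \<phi> \<psi> where iso: "iso_pair \<phi> \<psi> M N" using matroid_iso_imp_iso_pair by blast
  have "loopless M \<longleftrightarrow> loopless N" "ground M = {} \<longleftrightarrow> ground N = {}"
    using iso_pair_loopless[OF iso] iso_pair_loopless[OF iso_pair_sym[OF iso]]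
      iso_pair_image_ground[OF iso] by auto
  then show "(if loopless M \<and> ground M \<noteq> {} then chain_polynomial M else 0)
      = (if loopless N \<and> ground N \<noteq> {} then chain_polynomial N else 0)"
    using iso_pair_chain_polynomial[OF iso] by simp
qed

end
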